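(* Fix an integer $a\ge 2$ and a real constant $r>1$. For positive integers $k$ such that $n=rk$ is an integer, let $S$ be a sequence of $n$ independent letters, each uniformly distributed on $[a]=\{1,\dots,a\}$, and let $M_{k,a}(S)$ be the number of missing $k$-sequences of $S$. Put $$D(a,r)=\frac{(a-1)^{r-1}r^r}{a^{r-1}(r-1)^{r-1}}.$$ Then, as $k\to\infty$ (through values for which $rk$ is an integer), $\mathbb{E}(M_{k,a}(S))\to 0$ if $D(a,r)\le 1$, and $\mathbb{E}(M_{k,a}(S))\to\infty$ if $D(a,r)>1$.
   Context: For a sequence $S$ over $[a]$, the number of missing $k$-sequences $M_{k,a}(S)$ is the number of words $T\in[a]^k$ that do not occur in $S$ as a (not necessarily contiguous) subsequence. *)

theory Defs
  imports "HOL-Probability.Probability" "HOL-Library.Sublist"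
begin

text \<open>
  The alphabet \<open>[a]\<close> is \<open>{1..a}\<close> and words are lists; \<open>subseq T S\<close> is the library's
  not necessarily contiguous subsequence relation.
\<close>

definition words :: "nat \<Rightarrow> nat \<Rightarrow> nat list set" where
  "words k a = {T. length T = k \<and> set T \<subseteq> {1..a}}"

definition missing_count :: "nat \<Rightarrow> nat \<Rightarrow> nat list \<Rightarrow> nat" where
  "missing_count k a S = card {T \<in> words k a. \<not> subseq T S}"

definition random_seq :: "nat \<Rightarrow> nat \<Rightarrow> nat list pmf" where
  "random_seq n a = replicate_pmf n (pmf_of_set {1..a})"

definition expected_missing :: "nat \<Rightarrow> nat \<Rightarrow> nat \<Rightarrow> real" where
  "expected_missing n k a =
     measure_pmf.expectation (random_seq n a) (\<lambda>S. real (missing_count k a S))"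

definition D :: "nat \<Rightarrow> real \<Rightarrow> real" where
  "D a r = ((real a - 1) powr (r - 1) * r powr r) / (real a powr (r - 1) * (r - 1) powr (r - 1))"

text \<open>
  The filter for \<open>k \<rightarrow> \<infinity>\<close> along the positive integers \<open>k\<close> with \<open>r * k\<close> an integer. For
  irrational \<open>r\<close> there is no such \<open>k\<close>, so the filter is trivial and limits along it are vacuous.
\<close>

definition admissible_k :: "real \<Rightarrow> nat filter" where
  "admissible_k r = inf at_top (principal {k. 0 < k \<and> r * real k \<in> \<int>})"

end

theory Submission
  imports Defs
begin

text \<open>
  A word of length \<open>k\<close> is missing iff its greedy embedding matches fewer than \<open>k\<close> letters, so
  \<open>E = a^k * P(Bin(n, 1/a) < k)\<close>. For \<open>n = r * k\<close>, replacing the parameter \<open>1/a\<close> by \<open>1/r\<close> gives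
  \<open>a^k * P(Bin(n, 1/a) = k) = D^k * P(Bin(n, 1/r) = k)\<close>, and \<open>k\<close> is the mode of \<open>Bin(n, 1/r)\<close>.
  If \<open>D \<le> 1\<close> then \<open>a < r\<close>, so the binomial masses below \<open>k\<close> are dominated by a geometric
  series and \<open>E\<close> is at most a constant times \<open>D^k\<close> times the modal mass, which tends to 0.
  If \<open>D > 1\<close>, the term \<open>k - 1\<close> alone already forces \<open>E\<close> to infinity, since the modal mass is at
  least \<open>1 / (n + 1)\<close>.
\<close>

section \<open>Binomial point masses, their ratios and their mode\<close>

text \<open>The point mass of \<open>Bin(n, p)\<close> at \<open>j\<close>. For \<open>j > n\<close>
  the coefficient is 0, so the truncated exponent \<open>n - j\<close> is harmless.\<close>

definition binom_mass :: "real \<Rightarrow> nat \<Rightarrow> nat \<Rightarrow> real" where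
  "binom_mass p n j = real (n choose j) * p ^ j * (1 - p) ^ (n - j)"

lemma binom_mass_nonneg: "0 \<le> p \<Longrightarrow> p \<le> 1 \<Longrightarrow> 0 \<le> binom_mass p n j"
  by (simp add: binom_mass_def)

lemma binom_mass_pos: "0 < p \<Longrightarrow> p < 1 \<Longrightarrow> j \<le> n \<Longrightarrow> 0 < binom_mass p n j"
  by (simp add: binom_mass_def)

lemma sum_binom_mass: "(\<Sum>j\<le>n. binom_mass p n j) = 1"
  using binomial_ring[of p "1 - p" n] by (simp add: binom_mass_def)

lemma sum_binom_mass_le_1:
  assumes "0 \<le> p" "p \<le> 1"
  shows "(\<Sum>j\<in>J. binom_mass p n j) \<le> 1"
proof (cases "finite J")
  case True
  have "(\<Sum>j\<in>J. binom_mass p n j) = (\<Sum>j\<in>J \<inter> {..n}. binom_mass p n j)"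
    using True by (intro sum.mono_neutral_right) (auto simp: binom_mass_def)
  also have "\<dots> \<le> (\<Sum>j\<le>n. binom_mass p n j)"
    by (intro sum_mono2) (auto intro: binom_mass_nonneg assms)
  finally show ?thesis
    by (simp add: sum_binom_mass)
qed simp

text \<open>The ratio of neighbouring masses, cross-multiplied to avoid division. Every comparison
  of masses below rests on it.\<close>

lemma binom_mass_Suc:
  assumes "j < n"
  shows "binom_mass p n (Suc j) * (real (Suc j) * (1 - p)) = binom_mass p n j * ((real n - real j) * p)"
proof -
  have "Suc j * (n choose Suc j) = (n - j) * (n choose j)"
    using binomial_absorb_comp[of n j] binomial_absorption[of j n] by (cases n) auto
  then have *: "real (Suc j) * real (n choose Suc j) = (real n - real j) * real (n choose j)"
    using assms by (metis less_imp_le of_nat_diff of_nat_mult)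
  have pw: "(1 - p) ^ (n - j) = (1 - p) ^ (n - Suc j) * (1 - p)"
    using assms by (metis Suc_diff_Suc power_Suc2)
  have "binom_mass p n (Suc j) * (real (Suc j) * (1 - p)) =
      (real (Suc j) * real (n choose Suc j)) * (p ^ Suc j * ((1 - p) ^ (n - Suc j) * (1 - p)))"
    unfolding binom_mass_def by (simp only: ac_simps)
  also have "\<dots> = binom_mass p n j * ((real n - real j) * p)"
    unfolding * binom_mass_def pw by (simp add: ac_simps)
  finally show ?thesis .
qed

text \<open>By the ratio formula, the mass does not drop from \<open>i\<close> to
  \<open>Suc i\<close> exactly when \<open>i + 1 - p \<le> n * p = k\<close>. As
  \<open>0 < p < 1\<close>, this holds for \<open>i < k\<close> and fails for
  \<open>i \<ge> k\<close>.\<close>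

lemma binom_mass_mode:
  assumes p: "0 < p" "p < 1" and np: "real n * p = real k" and "j \<le> n"
  shows "binom_mass p n j \<le> binom_mass p n k"
proof -
  have up: "binom_mass p n i \<le> binom_mass p n (Suc i)" if "i < k" "i < n" for i
  proof -
    have "real (Suc i) * (1 - p) \<le> (real n - real i) * p"
      using that p np by (simp add: algebra_simps)
    then have "binom_mass p n i * (real (Suc i) * (1 - p)) \<le> binom_mass p n i * ((real n - real i) * p)"
      using p by (intro mult_left_mono binom_mass_nonneg) auto
    also have "\<dots> = binom_mass p n (Suc i) * (real (Suc i) * (1 - p))"
      using binom_mass_Suc[OF that(2), of p] by simp
    finally show ?thesis
      using p by (subst (asm) mult_le_cancel_right_pos) auto
  qed
  have down: "binom_mass p n (Suc i) \<le> binom_mass p n i" if "k \<le> i" "i < n" for i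
  proof -
    have "(real n - real i) * p \<le> real (Suc i) * (1 - p)"
      using that p np by (simp add: algebra_simps)
    then have "binom_mass p n i * ((real n - real i) * p) \<le> binom_mass p n i * (real (Suc i) * (1 - p))"
      using p by (intro mult_left_mono binom_mass_nonneg) auto
    then have "binom_mass p n (Suc i) * (real (Suc i) * (1 - p)) \<le> binom_mass p n i * (real (Suc i) * (1 - p))"
      using binom_mass_Suc[OF that(2), of p] by simp
    then show ?thesis
      using p by (subst (asm) mult_le_cancel_right_pos) auto
  qed
  have "real k \<le> real n"
    using np p mult_left_le[of p "real n"] by simp
  then have "k \<le> n" by simp
  show ?thesis
  proof (cases "j \<le> k")
    case True
    then show ?thesis
      by (rule inc_induct[where P = "\<lambda>i. binom_mass p n i \<le> binom_mass p n k"])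
        (use up \<open>k \<le> n\<close> in \<open>auto intro: order_trans\<close>)
  next
    case False
    then have "k \<le> j" by simp
    from this \<open>j \<le> n\<close> show ?thesis
    proof (induction j rule: dec_induct)
      case (step i)
      then show ?case using down[of i] by simp
    qed simp
  qed
qed

text \<open>The largest of \<open>n + 1\<close> masses with sum 1 is at least their average.\<close>

lemma binom_mass_mode_ge:
  assumes "0 < p" "p < 1" "real n * p = real k"
  shows "1 \<le> (real n + 1) * binom_mass p n k"
proof -
  have "1 = (\<Sum>j\<le>n. binom_mass p n j)" by (simp add: sum_binom_mass)
  also have "\<dots> \<le> real (card {..n}) * binom_mass p n k"
    by (intro sum_bounded_above) (use assms in \<open>auto intro: binom_mass_mode\<close>)
  finally show ?thesis by (simp add: algebra_simps)
qed

text \<open>In the induction step, \<open>\<rho> * f m\<close> and the new term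
  \<open>(1 - \<rho>) * f m\<close> add up to \<open>f m\<close>, which the growth assumption passes
  on to \<open>Suc m\<close>. The sign assumption at 0 settles the empty sum.\<close>

lemma sum_le_of_geometric_growth:
  fixes f :: "nat \<Rightarrow> real"
  assumes "\<And>j. j < m \<Longrightarrow> f j \<le> \<rho> * f (Suc j)" "0 \<le> \<rho> * f 0"
  shows "(1 - \<rho>) * (\<Sum>j<m. f j) \<le> \<rho> * f m"
  using assms
proof (induction m)
  case (Suc m)
  then have "(1 - \<rho>) * (\<Sum>j<m. f j) \<le> \<rho> * f m" "f m \<le> \<rho> * f (Suc m)" by auto
  then show ?case by (simp add: algebra_simps)
qed auto

section \<open>The expected number of missing words as a binomial tail\<close>

text \<open>Pascal's rule, read as conditioning on one trial: a success lowers the threshold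
  \<open>Suc k\<close> by one. The probability of missing a word obeys the same recursion.\<close>

lemma sum_binom_mass_recursion:
  "(\<Sum>j<Suc k. binom_mass p (Suc n) j) =
     p * (\<Sum>j<k. binom_mass p n j) + (1 - p) * (\<Sum>j<Suc k. binom_mass p n j)"
proof (induction k)
  case (Suc k)
  have "binom_mass p (Suc n) (Suc k) = p * binom_mass p n k + (1 - p) * binom_mass p n (Suc k)"
  \<comment> \<open>The exponent identity needs \<open>k < n\<close>; otherwise
    \<open>n choose Suc k\<close> is 0 and all failure exponents are 0.\<close>
  proof (cases "k < n")
    case True
    then have "n - k = Suc (n - Suc k)" by simp
    then show ?thesis by (simp add: binom_mass_def algebra_simps)
  next
    case False
    then show ?thesis by (auto simp: binom_mass_def algebra_simps)
  qed
  then show ?case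
    using Suc by (simp add: algebra_simps)
qed (simp add: binom_mass_def)

text \<open>Whatever letter of \<open>T\<close> is awaited, the next random letter matches it with
  probability \<open>1 / a\<close>. The count of greedy matches thus behaves like a binomial
  variable, and only the length of \<open>T\<close> matters.\<close>

lemma prob_not_subseq:
  assumes "1 \<le> a" "set T \<subseteq> {1..a}"
  shows "measure_pmf.prob (random_seq n a) {S. \<not> subseq T S} = (\<Sum>j<length T. binom_mass (1 / real a) n j)"
  using assms(2)
proof (induction n arbitrary: T)
  case 0
  show ?case
  proof (cases T)
    case (Cons t T')
    \<comment> \<open>Without trials the whole mass sits at 0, so a nonempty \<open>T\<close> is
      missing with probability 1.\<close>
    have "(\<Sum>j<length T. binom_mass (1 / real a) 0 j) = (\<Sum>j\<in>{0}. binom_mass (1 / real a) 0 j)"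
      using Cons by (intro sum.mono_neutral_right) (auto simp: binom_mass_def)
    then show ?thesis using Cons
      by (simp add: random_seq_def measure_return binom_mass_def indicator_def)
  qed (simp add: random_seq_def)
next
  case (Suc n)
  let ?P = "\<lambda>m T. measure_pmf.prob (random_seq m a) {S. \<not> subseq T S}"
  have A: "{1..a} \<noteq> {}" using assms(1) by auto
  show ?case
  proof (cases T)
    case (Cons t T')
    have t: "t \<in> {1..a}" and T': "set T' \<subseteq> {1..a}" using Suc.prems Cons by auto
    have step: "random_seq (Suc n) a = pmf_of_set {1..a} \<bind> (\<lambda>x. map_pmf ((#) x) (random_seq n a))"
      by (simp add: random_seq_def map_pmf_def)
    have "?P (Suc n) T = measure_pmf.expectation (pmf_of_set {1..a})
        (\<lambda>x. measure_pmf.prob (map_pmf ((#) x) (random_seq n a)) {S. \<not> subseq T S})"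
      unfolding step measure_pmf_bind
      using measurable_measure_pmf[of "\<lambda>x. map_pmf ((#) x) (random_seq n a)"]
      by (intro measure_pmf.measure_bind[where N = "count_space UNIV"])
        (simp_all only: measurable_pmf_measure1 measurable_count_space_eq1 sets_count_space Pow_UNIV UNIV_I)
    \<comment> \<open>Greedy matching loses nothing: if \<open>x = t\<close>, then
      \<open>t # T'\<close> embeds in \<open>x # S\<close> iff \<open>T'\<close> embeds in
      \<open>S\<close>; otherwise \<open>x\<close> is of no use.\<close>
    also have "\<dots> = measure_pmf.expectation (pmf_of_set {1..a})
        (\<lambda>x. if x = t then ?P n T' else ?P n T)"
      by (intro Bochner_Integration.integral_cong refl) (auto simp: Cons vimage_def)
    also have "\<dots> = (\<Sum>x\<in>{1..a}. if x = t then ?P n T' else ?P n T) / real a"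
      using A by (subst integral_pmf_of_set) auto
    also have "(\<Sum>x\<in>{1..a}. if x = t then ?P n T' else ?P n T) = ?P n T' + (real a - 1) * ?P n T"
      using t by (subst sum.remove[of _ t]) (auto simp: of_nat_diff)
    also have "(?P n T' + (real a - 1) * ?P n T) / real a =
        1 / real a * (\<Sum>j<length T'. binom_mass (1 / real a) n j) +
        (1 - 1 / real a) * (\<Sum>j<Suc (length T'). binom_mass (1 / real a) n j)"
      using Suc.IH[OF T'] Suc.IH[OF Suc.prems] assms(1) Cons by (simp add: field_simps)
    also have "\<dots> = (\<Sum>j<length T. binom_mass (1 / real a) (Suc n) j)"
      unfolding sum_binom_mass_recursion[symmetric] by (simp add: Cons)
    finally show ?thesis .
  qed simp
qed

text \<open>Linearity of expectation: all \<open>a ^ k\<close> words are missing with the same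
  probability.\<close>

lemma expected_missing_eq:
  assumes "1 \<le> a"
  shows "expected_missing n k a = real a ^ k * (\<Sum>j<k. binom_mass (1 / real a) n j)"
proof -
  have words: "words k a = {T. set T \<subseteq> {1..a} \<and> length T = k}"
    by (auto simp: words_def)
  then have fin: "finite (words k a)" and card: "card (words k a) = a ^ k"
    by (simp_all add: finite_lists_length_eq card_lists_length_eq)
  have "real (missing_count k a S) = (\<Sum>T\<in>words k a. indicator {S. \<not> subseq T S} S)" for S
    using fin by (simp add: missing_count_def indicator_def sum.If_cases Int_def)
  then have "expected_missing n k a =
      (\<Sum>T\<in>words k a. measure_pmf.prob (random_seq n a) {S. \<not> subseq T S})"
    by (simp add: expected_missing_def measure_pmf.integrable_const_bound[where B = 1])
  also have "\<dots> = (\<Sum>T\<in>words k a. \<Sum>j<k. binom_mass (1 / real a) n j)"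
    by (intro sum.cong refl) (use prob_not_subseq[OF assms] in \<open>auto simp: words_def\<close>)
  finally show ?thesis by (simp add: card)
qed

section \<open>The constant \<open>D\<close> and the change of parameter\<close>

text \<open>This form fits the change of parameter from \<open>1 / a\<close> to
  \<open>1 / r\<close>: each success contributes \<open>r\<close> (after scaling by
  \<open>a\<close>), each failure the quotient, and there are \<open>r - 1\<close> failures per
  success.\<close>

lemma D_eq:
  assumes "2 \<le> a" "1 < r"
  shows "D a r = r * ((1 - 1 / real a) / (1 - 1 / r)) powr (r - 1)"
proof -
  have "1 - 1 / real a = (real a - 1) / real a" "1 - 1 / r = (r - 1) / r"
    using assms by (auto simp: field_simps)
  moreover have "r powr r = r * r powr (r - 1)"
    using assms powr_add[of r 1 "r - 1"] by simp
  ultimately show ?thesis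
    using assms by (simp add: D_def powr_divide powr_mult)
qed

text \<open>If \<open>r \<le> a\<close>, the base of the power in \<open>D_eq\<close> is at least 1,
  hence \<open>D a r \<ge> r > 1\<close>.\<close>

lemma D_le_1_imp_less:
  assumes "2 \<le> a" "1 < r" "D a r \<le> 1"
  shows "real a < r"
proof (rule ccontr)
  assume "\<not> real a < r"
  then have "1 \<le> (1 - 1 / real a) / (1 - 1 / r)"
    using assms by (simp add: field_simps)
  then have "1 \<le> ((1 - 1 / real a) / (1 - 1 / r)) powr (r - 1)"
    using assms by (intro ge_one_powr_ge_zero) auto
  then have "r * 1 \<le> D a r"
    unfolding D_eq[OF assms(1,2)] using assms by (intro mult_left_mono) auto
  then show False using assms by simp
qed

lemma binom_mass_change_of_parameter:
  assumes "2 \<le> a" "1 < r" and n: "real n = r * real k"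
  shows "real a ^ k * binom_mass (1 / real a) n k = D a r ^ k * binom_mass (1 / r) n k"
proof -
  let ?x = "(1 - 1 / real a) / (1 - 1 / r)"
  have x: "0 < ?x" using assms by (simp add: field_simps)
  have "real k \<le> real n"
    unfolding n using assms by (simp add: mult_le_cancel_right1)
  then have "real (n - k) = (r - 1) * real k"
    by (simp add: of_nat_diff n[symmetric] left_diff_distrib)
  \<comment> \<open>Exactly \<open>(r - 1) * k\<close> failures occur, which turns the real exponent
    into the natural number \<open>n - k\<close>.\<close>
  then have "(?x powr (r - 1)) ^ k = ?x ^ (n - k)"
    using x by (metis powr_gt_zero powr_powr powr_realpow)
  then have "D a r ^ k = r ^ k * ((1 - 1 / real a) ^ (n - k) / (1 - 1 / r) ^ (n - k))"
    unfolding D_eq[OF assms(1,2)] by (simp add: power_mult_distrib power_divide)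
  then show ?thesis
    using assms by (simp add: binom_mass_def power_divide)
qed

section \<open>Upper and lower bounds for the expectation\<close>

text \<open>For \<open>j < k\<close>,
  \<open>n - j \<ge> (r - 1) * k \<ge> (r - 1) * (j + 1)\<close>, so the mass at \<open>j\<close> is
  at most \<open>(a - 1) / (r - 1) < 1\<close> times the mass at \<open>j + 1\<close>.\<close>

lemma expected_missing_upper:
  assumes "2 \<le> a" "real a < r" and n: "real n = r * real k"
  shows "(1 - (real a - 1) / (r - 1)) * expected_missing n k a \<le> D a r ^ k * binom_mass (1 / r) n k"
proof -
  define p where "p = 1 / real a"
  define \<rho> where "\<rho> = (real a - 1) / (r - 1)"
  have p: "0 < p" "p < 1" using assms by (auto simp: p_def)
  have \<rho>: "0 \<le> \<rho>" "\<rho> \<le> 1" using assms by (auto simp: \<rho>_def)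
  have "binom_mass p n j \<le> \<rho> * binom_mass p n (Suc j)" if "j < k" for j
  proof -
    have "real k \<le> real n"
      unfolding n using assms by (simp add: mult_le_cancel_right1)
    then have jn: "j < n" using that by simp
    have "(r - 1) * real (Suc j) \<le> (r - 1) * real k"
      using assms that by (intro mult_left_mono) auto
    then have *: "(r - 1) * real (Suc j) \<le> real n - real j"
      using that by (simp add: n algebra_simps)
    have "real (Suc j) * (1 - p) = \<rho> * ((r - 1) * real (Suc j) * p)"
      using assms by (simp add: \<rho>_def p_def field_simps)
    also have "\<dots> \<le> \<rho> * ((real n - real j) * p)"
      using * p \<rho> by (intro mult_left_mono mult_right_mono) auto
    finally have "binom_mass p n (Suc j) * (real (Suc j) * (1 - p)) \<le>
        binom_mass p n (Suc j) * (\<rho> * ((real n - real j) * p))"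
      using p by (intro mult_left_mono binom_mass_nonneg) auto
    then have "binom_mass p n j * ((real n - real j) * p) \<le>
        (\<rho> * binom_mass p n (Suc j)) * ((real n - real j) * p)"
      unfolding binom_mass_Suc[OF jn] by (simp only: ac_simps)
    then show ?thesis
      using p jn by (subst (asm) mult_le_cancel_right_pos) auto
  qed
  then have "(1 - \<rho>) * (\<Sum>j<k. binom_mass p n j) \<le> \<rho> * binom_mass p n k"
    using \<rho> p by (intro sum_le_of_geometric_growth) (auto intro!: mult_nonneg_nonneg binom_mass_nonneg)
  also have "\<dots> \<le> binom_mass p n k"
    using \<rho> p by (intro mult_left_le_one_le binom_mass_nonneg) auto
  finally have "real a ^ k * ((1 - \<rho>) * (\<Sum>j<k. binom_mass p n j)) \<le> real a ^ k * binom_mass p n k"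
    by (intro mult_left_mono) auto
  moreover have "real a ^ k * binom_mass p n k = D a r ^ k * binom_mass (1 / r) n k"
    unfolding p_def using assms by (intro binom_mass_change_of_parameter) auto
  moreover have "expected_missing n k a = real a ^ k * (\<Sum>j<k. binom_mass p n j)"
    unfolding p_def using assms by (intro expected_missing_eq) auto
  ultimately show ?thesis
    unfolding \<rho>_def by (simp only: mult.left_commute)
qed

text \<open>The summand at \<open>k - 1\<close> is at least \<open>1 / r\<close> times the mass at
  \<open>k\<close>; after the change of parameter the mode bound supplies
  \<open>1 / (n + 1)\<close>.\<close>

lemma expected_missing_lower:
  assumes "2 \<le> a" "1 < r" "0 < k" and n: "real n = r * real k"
  shows "D a r ^ k / (r * (r * real k + 1)) \<le> expected_missing n k a"
proof -
  define p where "p = 1 / real a"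
  have p: "0 < p" "p < 1" using assms by (auto simp: p_def)
  have "real k < real n"
    unfolding n using assms by simp
  define j where "j = k - 1"
  have j: "k = Suc j" "j < n" using assms(3) \<open>real k < real n\<close> by (auto simp: j_def)
  have mass: "0 \<le> binom_mass p n i" for i using p by (simp add: binom_mass_nonneg)
  \<comment> \<open>Here \<open>a \<ge> 2\<close> enters, as \<open>p \<le> 1 - p\<close>.\<close>
  have "real k * p \<le> real k * (1 - p)"
    using assms by (intro mult_left_mono) (auto simp: p_def field_simps)
  then have "binom_mass p n k * (real k * p) \<le> binom_mass p n k * (real k * (1 - p))"
    using mass by (rule mult_left_mono)
  also have "\<dots> = binom_mass p n j * ((real n - real j) * p)"
    using binom_mass_Suc[OF j(2), of p] j by simp
  \<comment> \<open>Bounding \<open>n - j\<close> crudely by \<open>n\<close> is the source of the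
    factor \<open>r\<close>.\<close>
  also have "\<dots> \<le> binom_mass p n j * ((r * real k) * p)"
    using p mass n by (intro mult_left_mono mult_right_mono) auto
  finally have "binom_mass p n k * (real k * p) \<le> (r * binom_mass p n j) * (real k * p)"
    by (simp add: ac_simps)
  then have "binom_mass p n k \<le> r * binom_mass p n j"
    using p assms(3) by (subst (asm) mult_le_cancel_right_pos) auto
  also have "\<dots> \<le> r * (\<Sum>j<k. binom_mass p n j)"
    using assms mass j by (intro mult_left_mono member_le_sum) auto
  finally have "real a ^ k * binom_mass p n k \<le> real a ^ k * (r * (\<Sum>j<k. binom_mass p n j))"
    by (intro mult_left_mono) auto
  then have "D a r ^ k * binom_mass (1 / r) n k \<le> r * expected_missing n k a"
    using assms binom_mass_change_of_parameter[OF assms(1,2) n]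
    by (simp add: expected_missing_eq p_def ac_simps)
  moreover have "D a r ^ k / (r * real k + 1) \<le> D a r ^ k * binom_mass (1 / r) n k"
  proof -
    have D0: "0 \<le> D a r" using assms by (simp add: D_def)
    have "1 \<le> (r * real k + 1) * binom_mass (1 / r) n k"
      using binom_mass_mode_ge[of "1 / r" n k] assms by simp
    moreover have "0 < r * real k + 1" using assms by (simp add: add_nonneg_pos)
    ultimately have "1 / (r * real k + 1) \<le> binom_mass (1 / r) n k"
      by (simp add: divide_le_eq mult.commute)
    then show ?thesis
      using mult_left_mono[of "1 / (r * real k + 1)" "binom_mass (1 / r) n k" "D a r ^ k"] D0 by simp
  qed
  ultimately have "D a r ^ k / (r * real k + 1) \<le> r * expected_missing n k a" by simp
  then have "D a r ^ k / (r * real k + 1) / r \<le> r * expected_missing n k a / r"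
    using assms by (intro divide_right_mono) auto
  then show ?thesis
    using assms by (simp add: mult.commute)
qed

section \<open>Decay of the modal mass\<close>

text \<open>No Stirling estimate is involved: for fixed \<open>M\<close>, the masses at
  \<open>k, ..., k + M - 1\<close> are asymptotically equal and sum to at most 1, so none can stay
  much above \<open>1 / M\<close>.\<close>

lemma binom_mass_mode_tendsto_0:
  fixes n :: "nat \<Rightarrow> nat"
  assumes r: "1 < r" and F: "F \<le> at_top" and n: "eventually (\<lambda>k. real (n k) = r * real k) F"
  shows "((\<lambda>k. binom_mass (1 / r) (n k) k) \<longlongrightarrow> 0) F"
proof -
  define b where "b i k = binom_mass (1 / r) (n k) (k + i)" for i k
  have p: "0 < 1 / r" "1 / r < 1" using r by auto
  have b_nonneg: "0 \<le> b i k" for i k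
    using p by (simp add: b_def binom_mass_nonneg)
  \<comment> \<open>As \<open>n - k = (r - 1) * k\<close> is unbounded, each fixed neighbour
    \<open>k + i\<close> eventually lies below \<open>n\<close>, where masses are positive and the
    ratio formula applies.\<close>
  have large: "eventually (\<lambda>k. real i < (r - 1) * real k \<and> 0 < k) F" for i :: nat
  proof (rule filter_leD[OF F])
    have "filterlim (\<lambda>k. (r - 1) * real k) at_top at_top"
      using r by (intro filterlim_tendsto_pos_mult_at_top[OF tendsto_const] filterlim_real_sequentially) simp
    then show "eventually (\<lambda>k. real i < (r - 1) * real k \<and> 0 < k) at_top"
      by (intro eventually_conj eventually_gt_at_top) (simp add: filterlim_at_top_dense)
  qed
  have b_pos: "eventually (\<lambda>k. 0 < b i k) F" for i
    using n large[of i]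
  proof eventually_elim
    case (elim k)
    then have "real (k + i) < real (n k)" by (simp add: algebra_simps)
    then show ?case unfolding b_def using p by (intro binom_mass_pos) auto
  qed
  \<comment> \<open>The mass is locally flat at its mode, so any fixed number of neighbours carry the same mass.\<close>
  have flat: "((\<lambda>k. b i k / b 0 k) \<longlongrightarrow> 1) F" for i
  proof (induction i)
    case 0
    have "eventually (\<lambda>k. b 0 k / b 0 k = 1) F"
      using b_pos[of 0] by eventually_elim simp
    then show ?case by (rule tendsto_eventually)
  next
    case (Suc i)
    \<comment> \<open>This is the ratio of the masses at \<open>k + i + 1\<close> and
      \<open>k + i\<close>, written as 1 minus a constant over \<open>k + i + 1\<close>.\<close>
    have "((\<lambda>k. 1 - ((r - 1) * (real i + 1) + real i) / (r - 1) * inverse (real (k + Suc i))) \<longlongrightarrow> 1 - ((r - 1) * (real i + 1) + real i) / (r - 1) * 0) at_top"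
      by (intro tendsto_intros LIMSEQ_ignore_initial_segment[OF lim_inverse_n])
    moreover have "1 - ((r - 1) * (real i + 1) + real i) / (r - 1) * inverse (real (k + Suc i)) =
        ((r - 1) * real k - real i) / ((r - 1) * (real k + real i + 1))" for k
    proof -
      have "0 < real k + real i + 1" "0 < r - 1" using r by auto
      then show ?thesis by (simp add: divide_simps) (simp add: algebra_simps)
    qed
    ultimately have "((\<lambda>k. ((r - 1) * real k - real i) / ((r - 1) * (real k + real i + 1))) \<longlongrightarrow> 1) at_top"
      by simp
    then have "((\<lambda>k. ((r - 1) * real k - real i) / ((r - 1) * (real k + real i + 1))) \<longlongrightarrow> 1) F"
      using F by (rule tendsto_mono[rotated])
    then have "((\<lambda>k. b i k / b 0 k * (((r - 1) * real k - real i) / ((r - 1) * (real k + real i + 1)))) \<longlongrightarrow> 1 * 1) F"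
      by (intro tendsto_mult Suc)
    moreover have "eventually (\<lambda>k. b i k / b 0 k * (((r - 1) * real k - real i) / ((r - 1) * (real k + real i + 1)))
        = b (Suc i) k / b 0 k) F"
      using n large[of i]
    proof eventually_elim
      case (elim k)
      then have "real (k + i) < real (n k)" by (simp add: algebra_simps)
      then have "k + i < n k" by simp
      from binom_mass_Suc[OF this, of "1 / r"]
      have "b (Suc i) k * ((real k + real i + 1) * (1 - 1 / r)) = b i k * (((r - 1) * real k - real i) * (1 / r))"
        using elim by (simp add: b_def algebra_simps)
      then have "b (Suc i) k * ((real k + real i + 1) * (1 - 1 / r)) * r = b i k * (((r - 1) * real k - real i) * (1 / r)) * r"
        by simp
      moreover have "(1 - 1 / r) * r = r - 1" "1 / r * r = 1"
        using r by (auto simp: field_simps)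
      ultimately have "b (Suc i) k * ((real k + real i + 1) * (r - 1)) = b i k * ((r - 1) * real k - real i)"
        by (simp only: mult.assoc mult_1_right)
      moreover have "0 < (real k + real i + 1) * (r - 1)"
        using r by (intro mult_pos_pos) auto
      ultimately have "b (Suc i) k = b i k * ((r - 1) * real k - real i) / ((r - 1) * (real k + real i + 1))"
        using r by (simp add: eq_divide_eq mult.commute)
      then show ?case by simp
    qed
    ultimately show ?case
      by (simp add: filterlim_cong)
  qed
  have "((\<lambda>k. b 0 k) \<longlongrightarrow> 0) F"
  proof (rule order_tendstoI)
    fix e :: real assume "e < 0"
    then show "eventually (\<lambda>k. e < b 0 k) F"
      using b_nonneg by (intro always_eventually) (auto intro: less_le_trans)
  next
    fix e :: real assume "0 < e"
    \<comment> \<open>The sum of \<open>M\<close> ratios tends to \<open>M > 1 / e\<close> but never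
      exceeds \<open>1 / b 0 k\<close> when \<open>b 0 k > 0\<close>; this forces
      \<open>b 0 k < e\<close>.\<close>
    then obtain M :: nat where M: "1 / e < real M" using reals_Archimedean2 by blast
    have "((\<lambda>k. \<Sum>i<M. b i k / b 0 k) \<longlongrightarrow> (\<Sum>i<M. 1)) F"
      by (intro tendsto_sum flat)
    then have "eventually (\<lambda>k. 1 / e < (\<Sum>i<M. b i k / b 0 k)) F"
      using M by (intro order_tendstoD) auto
    then show "eventually (\<lambda>k. b 0 k < e) F"
      using b_pos[of 0]
    proof eventually_elim
      case (elim k)
      have "(\<Sum>i<M. b i k) = (\<Sum>j\<in>(+) k ` {..<M}. binom_mass (1 / r) (n k) j)"
        by (subst sum.reindex) (auto simp: b_def)
      also have "\<dots> \<le> 1"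
        using p by (intro sum_binom_mass_le_1) auto
      finally have "(\<Sum>i<M. b i k / b 0 k) \<le> 1 / b 0 k"
        using elim(2) by (simp add: sum_divide_distrib[symmetric] divide_right_mono)
      then have "1 / e < 1 / b 0 k" using elim(1) by simp
      then show ?case using elim(2) \<open>0 < e\<close> by (simp add: field_simps)
    qed
  qed
  then show ?thesis by (simp add: b_def)
qed

section \<open>Passage to the limit\<close>

lemma filterlim_power_over_linear:
  fixes d u v :: real
  assumes "1 < d" "0 < u" "0 \<le> v"
  shows "filterlim (\<lambda>k. d ^ k / (u * real k + v)) at_top at_top"
proof -
  have "(\<lambda>k. real k / d ^ k) \<longlonglongrightarrow> 0"
    using powser_times_n_limit_0[of "inverse d"] assms
    by (simp add: field_simps)
  moreover have "(\<lambda>k. inverse d ^ k) \<longlonglongrightarrow> 0"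
    using assms by (intro LIMSEQ_power_zero) (simp add: field_simps)
  ultimately have "(\<lambda>k. u * (real k / d ^ k) + v * inverse d ^ k) \<longlonglongrightarrow> u * 0 + v * 0"
    by (intro tendsto_add tendsto_mult_left)
  then have "(\<lambda>k. (u * real k + v) / d ^ k) \<longlonglongrightarrow> 0"
    by (simp add: add_divide_distrib power_inverse divide_inverse distrib_right mult.assoc)
  \<comment> \<open>Positivity makes the reciprocal of this null sequence tend to plus
    infinity.\<close>
  moreover have "eventually (\<lambda>k. 0 < (u * real k + v) / d ^ k) sequentially"
    using eventually_gt_at_top[of 0] by eventually_elim (use assms in \<open>simp add: add_pos_nonneg\<close>)
  ultimately have "filterlim (\<lambda>k. inverse ((u * real k + v) / d ^ k)) at_top sequentially"
    by (rule filterlim_inverse_at_top)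
  then show ?thesis by simp
qed

text \<open>For admissible \<open>k\<close> the product \<open>r * k\<close> is a nonnegative
  integer, so rounding changes nothing.\<close>

lemma eventually_admissible_k:
  assumes "1 < r"
  shows "eventually (\<lambda>k. 0 < k \<and> real (nat \<lfloor>r * real k\<rfloor>) = r * real k) (admissible_k r)"
  unfolding admissible_k_def eventually_inf_principal
  using assms by (intro always_eventually) (auto elim!: Ints_cases)

theorem mainTheorem4:
  fixes a :: nat and r :: real
  assumes "2 \<le> a" and "1 < r"
  shows "(D a r \<le> 1 \<longrightarrow>
            ((\<lambda>k. expected_missing (nat \<lfloor>r * real k\<rfloor>) k a) \<longlongrightarrow> 0) (admissible_k r)) \<and>
         (D a r > 1 \<longrightarrow>
            filterlim (\<lambda>k. expected_missing (nat \<lfloor>r * real k\<rfloor>) k a) at_top (admissible_k r))"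
proof (intro conjI impI)
  let ?n = "\<lambda>k. nat \<lfloor>r * real k\<rfloor>"
  have F: "admissible_k r \<le> at_top" by (simp add: admissible_k_def)
  note adm = eventually_admissible_k[OF assms(2)]
  {
    assume D: "D a r \<le> 1"
    then have ar: "real a < r" using assms D_le_1_imp_less by blast
    define c where "c = 1 - (real a - 1) / (r - 1)"
    have c: "0 < c" using ar assms by (simp add: c_def)
    have D0: "0 \<le> D a r" using assms by (simp add: D_def)
    have "((\<lambda>k. binom_mass (1 / r) (?n k) k) \<longlongrightarrow> 0) (admissible_k r)"
      using adm by (intro binom_mass_mode_tendsto_0 assms F) (auto elim: eventually_mono)
    then have lim: "((\<lambda>k. binom_mass (1 / r) (?n k) k / c) \<longlongrightarrow> 0) (admissible_k r)"
      using tendsto_divide_zero by blast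
    show "((\<lambda>k. expected_missing (?n k) k a) \<longlongrightarrow> 0) (admissible_k r)"
    proof (rule tendsto_sandwich[OF _ _ tendsto_const lim])
      show "eventually (\<lambda>k. 0 \<le> expected_missing (?n k) k a) (admissible_k r)"
        by (intro always_eventually) (simp add: expected_missing_def)
      show "eventually (\<lambda>k. expected_missing (?n k) k a \<le> binom_mass (1 / r) (?n k) k / c) (admissible_k r)"
        using adm
      proof eventually_elim
        case (elim k)
        have "c * expected_missing (?n k) k a \<le> D a r ^ k * binom_mass (1 / r) (?n k) k"
          unfolding c_def using elim by (intro expected_missing_upper assms ar) auto
        \<comment> \<open>Only \<open>D ^ k \<le> 1\<close> is used; the decay comes from the modal
          mass, so the boundary case \<open>D = 1\<close> is covered.\<close>
        also have "\<dots> \<le> binom_mass (1 / r) (?n k) k"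
          using D D0 assms by (intro mult_left_le_one_le binom_mass_nonneg power_le_one) auto
        finally show ?case using c by (simp add: le_divide_eq mult.commute)
      qed
    qed
  next
    assume D: "1 < D a r"
    have "filterlim (\<lambda>k. D a r ^ k / (r * (r * real k + 1))) at_top (admissible_k r)"
      using filterlim_power_over_linear[OF D, of "r * r" r] assms
      by (intro filterlim_mono[OF _ order_refl F]) (simp add: algebra_simps)
    then show "filterlim (\<lambda>k. expected_missing (?n k) k a) at_top (admissible_k r)"
      by (rule filterlim_at_top_mono)
        (use adm in eventually_elim, use assms expected_missing_lower in auto)
  }
qed

end
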